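(* Let $A,B\in \mathrm{SL}(2,\mathbb{Z})$ be hyperbolic. Then $A$ and $B$ are integer conjugate in $\mathrm{SL}(2,\mathbb{Z})$ if and only if $Q_A$ and $Q_B$ are properly equivalent in $\mathcal{Q}$.
   Context: A matrix in $\mathrm{SL}(2,\mathbb{Z})$ is hyperbolic if it has distinct real eigenvalues, i.e. if it lies in $\mathcal{M}^+\cup\mathcal{M}^-$, where $\mathcal{M}^+=\{A\in \mathrm{SL}(2,\mathbb{Z}) : \mathrm{tr}(A)>2\}$ and $\mathcal{M}^-=\{A\in \mathrm{SL}(2,\mathbb{Z}) : \mathrm{tr}(A)<-2\}$. Matrices $A,B\in\mathrm{SL}(2,\mathbb{Z})$ are integer conjugate if there is $C\in \mathrm{SL}(2,\mathbb{Z})$ with $B=CAC^{-1}$. A form is a binary quadratic form $f(X,Y)=aX^2+bXY+cY^2$ with $a,b,c\in\mathbb{Z}$; its discriminant is $\Delta_f=b^2-4ac$, and $f$ is indefinite if and only if $\Delta_f>0$. $\mathcal{Q}$ is the set of indefinite forms $Q$ such that $\Delta_Q+4$ is a perfect square. For $U=\begin{pmatrix} s& t\\ u& v\end{pmatrix}\in\mathrm{SL}(2,\mathbb{Z})$ put $(Uf)(X,Y)=f(sX+tY,\,uX+vY)$; two forms $f,g$ are properly equivalent if $g=Uf$ for some $U\in\mathrm{SL}(2,\mathbb{Z})$. For $A=\begin{pmatrix} a& b\\ c& d\end{pmatrix}\in\mathcal{M}^+\cup\mathcal{M}^-$, the associated form is $Q_A(x,y)=cx^2+(d-a)xy-by^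2\in\mathcal{Q}$.
   Formalization: The "if" direction is stated only for A, B both in M^+ or both in M^-; it fails otherwise: A=(2 1;1 1) and B=-A^{-1}=(-1 1;1 -2) have Q_A=Q_B but traces 3 and -3. The "only if" direction is for all hyperbolic A, B. *)

theory Defs
  imports "HOL-Analysis.Analysis"
begin

definition SL2Z :: "(int^2^2) set" where
  "SL2Z = {A. det A = 1}"

definition M_plus :: "(int^2^2) set" where
  "M_plus = {A \<in> SL2Z. trace A > 2}"

definition M_minus :: "(int^2^2) set" where
  "M_minus = {A \<in> SL2Z. trace A < -2}"

definition real_eigenvalue :: "int^2^2 \<Rightarrow> real \<Rightarrow> bool" where
  "real_eigenvalue A l \<longleftrightarrow> (\<exists>v::real^2. v \<noteq> 0 \<and> map_matrix real_of_int A *v v = l *s v)"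

definition hyperbolic :: "int^2^2 \<Rightarrow> bool" where
  "hyperbolic A \<longleftrightarrow> (\<exists>l m. l \<noteq> m \<and> real_eigenvalue A l \<and> real_eigenvalue A m)"

definition integer_conjugate :: "int^2^2 \<Rightarrow> int^2^2 \<Rightarrow> bool" where
  "integer_conjugate A B \<longleftrightarrow> (\<exists>C \<in> SL2Z. B = C ** A ** matrix_inv C)"

text \<open>\<open>Form a b c\<close> is the form \<open>a X^2 + b X Y + c Y^2\<close>.\<close>

datatype form = Form int int int

fun form_eval :: "form \<Rightarrow> 'a::comm_ring_1 \<Rightarrow> 'a \<Rightarrow> 'a" where
  "form_eval (Form a b c) x y = of_int a * x^2 + of_int b * x * y + of_int c * y^2"

fun discr :: "form \<Rightarrow> int" where
  "discr (Form a b c) = b^2 - 4 * a * c"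

definition indefinite :: "form \<Rightarrow> bool" where
  "indefinite f \<longleftrightarrow> discr f > 0"

definition Q_forms :: "form set" where
  "Q_forms = {f. indefinite f \<and> (\<exists>k. discr f + 4 = k^2)}"

text \<open>The coefficients of \<open>f (s X + t Y, u X + v Y)\<close>, where \<open>s, t, u, v\<close> are the entries of \<open>U\<close>;
  see \<open>form_eval_form_act\<close> below.\<close>

fun form_act :: "int^2^2 \<Rightarrow> form \<Rightarrow> form" where
  "form_act U (Form a b c) =
     (let s = U$1$1; t = U$1$2; u = U$2$1; v = U$2$2 in
       Form (a * s^2 + b * s * u + c * u^2)
            (2 * a * s * t + b * (s * v + t * u) + 2 * c * u * v)
            (a * t^2 + b * t * v + c * v^2))"

definition properly_equivalent_in :: "form set \<Rightarrow> form \<Rightarrow> form \<Rightarrow> bool" where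
  "properly_equivalent_in S f g \<longleftrightarrow> f \<in> S \<and> g \<in> S \<and> (\<exists>U \<in> SL2Z. g = form_act U f)"

definition assoc_form :: "int^2^2 \<Rightarrow> form" where
  "assoc_form A = Form (A$2$1) (A$2$2 - A$1$1) (- A$1$2)"

lemma form_eval_form_act:
  "form_eval (form_act U f) x y =
     form_eval f (of_int (U$1$1) * x + of_int (U$1$2) * y) (of_int (U$2$1) * x + of_int (U$2$2) * y)"
  by (cases f) (simp add: Let_def algebra_simps power2_eq_square)

lemma form_eval_inject:
  assumes "\<And>x y :: int. form_eval f x y = form_eval g x y"
  shows "f = g"
  using assms[of 1 0] assms[of 0 1] assms[of 1 1] by (cases f; cases g) auto

lemma real_eigenvalue_iff:
  "real_eigenvalue A l \<longleftrightarrow> l^2 - of_int (trace A) * l + of_int (det A) = 0"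
proof -
  let ?M = "map_matrix real_of_int A - mat l"
  have "real_eigenvalue A l \<longleftrightarrow> (\<exists>v. v \<noteq> 0 \<and> ?M *v v = 0)"
    unfolding real_eigenvalue_def
    by (simp add: vec_eq_iff forall_2 matrix_vector_mult_def sum_2 mat_def algebra_simps)
  also have "\<dots> \<longleftrightarrow> \<not> invertible ?M"
    by (metis invertible_left_inverse matrix_left_invertible_ker)
  also have "\<dots> \<longleftrightarrow> det ?M = 0"
    by (simp add: invertible_det_nz)
  also have "det ?M = l^2 - of_int (trace A) * l + of_int (det A)"
    by (simp add: det_2 mat_def trace_def sum_2 algebra_simps power2_eq_square)
  finally show ?thesis .
qed

lemma hyperbolic_iff:
  assumes "A \<in> SL2Z"
  shows "hyperbolic A \<longleftrightarrow> A \<in> M_plus \<union> M_minus"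
proof -
  define t where "t = real_of_int (trace A)"
  have d: "det A = 1" using assms by (simp add: SL2Z_def)
  have ev: "real_eigenvalue A l \<longleftrightarrow> l^2 - t * l + 1 = 0" for l
    by (simp add: real_eigenvalue_iff t_def d)
  have "hyperbolic A \<longleftrightarrow> t^2 > 4"
  proof
    assume "hyperbolic A"
    then obtain l m where lm: "l \<noteq> m" "l^2 - t * l + 1 = 0" "m^2 - t * m + 1 = 0"
      unfolding hyperbolic_def ev by blast
    have "(l - m) * (l + m - t) = 0"
      using lm(2,3) by (simp add: algebra_simps power2_eq_square)
    then have t: "t = l + m" using lm(1) by simp
    then have "l * m = 1" using lm(2) by (simp add: algebra_simps power2_eq_square)
    then have "t^2 - 4 = (l - m)^2" unfolding t by (simp add: algebra_simps power2_eq_square)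
    then show "t^2 > 4" using lm(1) by (smt (verit) zero_less_power2)
  next
    assume t: "t^2 > 4"
    define r where "r = sqrt (t^2 - 4)"
    have r: "r^2 = t^2 - 4" "r > 0" using t by (auto simp: r_def)
    have "real_eigenvalue A ((t + r) / 2)" "real_eigenvalue A ((t - r) / 2)"
      using r(1) by (simp_all add: ev field_simps power2_eq_square)
    moreover have "(t + r) / 2 \<noteq> (t - r) / 2" using r(2) by simp
    ultimately show "hyperbolic A" unfolding hyperbolic_def by blast
  qed
  also have "\<dots> \<longleftrightarrow> \<bar>t\<bar> > 2"
    using abs_less_iff real_sqrt_less_iff[of 4 "t^2"] by simp
  also have "\<dots> \<longleftrightarrow> A \<in> M_plus \<union> M_minus"
    using assms by (auto simp: M_plus_def M_minus_def t_def)
  finally show ?thesis .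
qed

lemma discr_assoc_form:
  assumes "A \<in> SL2Z"
  shows "discr (assoc_form A) = (trace A)^2 - 4"
proof -
  have "A$1$1 * A$2$2 = 1 + A$1$2 * A$2$1"
    using assms by (simp add: SL2Z_def det_2)
  then show ?thesis
    by (simp add: assoc_form_def trace_def sum_2 power2_eq_square algebra_simps)
qed

lemma assoc_form_in_Q_forms:
  assumes "A \<in> SL2Z" "hyperbolic A"
  shows "assoc_form A \<in> Q_forms"
proof -
  have "\<bar>trace A\<bar> > 2"
    using assms hyperbolic_iff by (auto simp: M_plus_def M_minus_def)
  then have "2^2 < \<bar>trace A\<bar>^2" by (intro power_strict_mono) auto
  then show ?thesis
    using assms(1) by (auto simp: Q_forms_def indefinite_def discr_assoc_form)
qed

lemma trace_conjugate:
  assumes "integer_conjugate A B"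
  shows "trace B = trace A"
proof -
  from assms obtain C where C: "det C = 1" "B = C ** A ** matrix_inv C"
    by (auto simp: integer_conjugate_def SL2Z_def)
  define D :: "int^2^2" where
    "D = vector [vector [C$2$2, - C$1$2], vector [- C$2$1, C$1$1]]"
  have "C ** D = mat 1 \<and> D ** C = mat 1"
    using C(1) by (auto simp: D_def vec_eq_iff forall_2 matrix_matrix_mult_def sum_2 mat_def det_2
        algebra_simps)
  then have "C ** matrix_inv C = mat 1 \<and> matrix_inv C ** C = mat 1"
    unfolding matrix_inv_def by (rule someI)
  then show ?thesis
    unfolding C(2) by (metis matrix_mul_assoc matrix_mul_lid trace_mul_sym)
qed

text \<open>The associated form does not see the sign of the trace: \<open>A\<close> and \<open>- A\<inverse>\<close> have the same
  associated form but opposite traces. So equivalence of the forms implies conjugacy only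
  within \<open>M_plus\<close> and within \<open>M_minus\<close>.\<close>

lemma assoc_form_opposite_traces:
  "\<exists>A B. A \<in> SL2Z \<and> B \<in> SL2Z \<and> hyperbolic A \<and> hyperbolic B \<and>
     properly_equivalent_in Q_forms (assoc_form A) (assoc_form B) \<and> \<not> integer_conjugate A B"
proof -
  define A B :: "int^2^2" where
    "A = vector [vector [2, 1], vector [1, 1]]" and "B = vector [vector [-1, 1], vector [1, -2]]"
  have SL: "A \<in> SL2Z" "B \<in> SL2Z" by (simp_all add: SL2Z_def A_def B_def det_2)
  have tr: "trace A = 3" "trace B = -3" by (simp_all add: A_def B_def trace_def sum_2)
  have hyp: "hyperbolic A" "hyperbolic B"
    using SL tr by (simp_all add: hyperbolic_iff M_plus_def M_minus_def)
  have "assoc_form B = form_act (mat 1) (assoc_form A)"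
    by (simp add: assoc_form_def A_def B_def mat_def Let_def)
  moreover have "mat 1 \<in> SL2Z" by (simp add: SL2Z_def)
  ultimately have "properly_equivalent_in Q_forms (assoc_form A) (assoc_form B)"
    using SL hyp assoc_form_in_Q_forms unfolding properly_equivalent_in_def by blast
  moreover have "\<not> integer_conjugate A B" using trace_conjugate tr by fastforce
  ultimately show ?thesis using SL hyp by blast
qed

end

theory Submission
  imports Defs
begin

text \<open>The form satisfies \<open>Q_A(v) = det (v | A v)\<close>, hence replacing \<open>A\<close> by \<open>U\<inverse> A U\<close> with
  \<open>det U = 1\<close> substitutes \<open>U v\<close> for \<open>v\<close>. Conversely, an element of \<open>SL(2,\<int>)\<close> is determined by its
  form and its trace; the form yields the trace up to sign, because its discriminant is
  \<open>tr(A)\<^sup>2 - 4\<close>.\<close>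

text \<open>\<open>matrix_inv\<close> is a choice term; explicit entries let identities be checked
  by expansion.\<close>

definition adjugate2 :: "'a::comm_ring_1^2^2 \<Rightarrow> 'a^2^2" where
  "adjugate2 U = vector [vector [U$2$2, - U$1$2], vector [- U$2$1, U$1$1]]"

lemma adjugate2_nth [simp]:
  "adjugate2 U $ 1 $ 1 = U$2$2" "adjugate2 U $ 1 $ 2 = - U$1$2"
  "adjugate2 U $ 2 $ 1 = - U$2$1" "adjugate2 U $ 2 $ 2 = U$1$1"
  by (simp_all add: adjugate2_def)

lemma adjugate2_adjugate2: "adjugate2 (adjugate2 U) = U"
  by (simp add: vec_eq_iff forall_2)

lemma det_adjugate2: "det (adjugate2 U) = det U"
  by (simp add: det_2 mult.commute)

lemma matrix_inv_eq_adjugate2: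
  fixes U :: "'a::comm_ring_1^2^2"
  assumes "det U = 1"
  shows "matrix_inv U = adjugate2 U"
proof -
  have inv: "U ** adjugate2 U = mat 1 \<and> adjugate2 U ** U = mat 1"
    using assms by (auto simp: vec_eq_iff forall_2 matrix_matrix_mult_def sum_2 mat_def det_2
        algebra_simps)
  then have "U ** matrix_inv U = mat 1 \<and> matrix_inv U ** U = mat 1"
    unfolding matrix_inv_def by (rule someI)
  then show ?thesis
    using inv by (metis matrix_mul_assoc matrix_mul_lid matrix_mul_rid)
qed

text \<open>With the adjugate in place of the inverse this is a polynomial identity, valid for every \<open>U\<close>.\<close>

lemma assoc_form_conjugate:
  "assoc_form (adjugate2 U ** A ** U) = form_act U (assoc_form A)"
  by (simp add: assoc_form_def Let_def matrix_matrix_mult_def sum_2 power2_eq_square algebra_simps)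

text \<open>\<open>U\<close> is the inverse of \<open>C\<close>: with the inverse on the left,
  conjugation matches the substitution in \<open>form_act\<close>.\<close>

lemma integer_conjugate_iff_adjugate2:
  "integer_conjugate A B \<longleftrightarrow> (\<exists>U \<in> SL2Z. B = adjugate2 U ** A ** U)"
proof
  assume "integer_conjugate A B"
  then obtain C where "det C = 1" "B = C ** A ** matrix_inv C"
    by (auto simp: integer_conjugate_def SL2Z_def)
  then show "\<exists>U \<in> SL2Z. B = adjugate2 U ** A ** U"
    by (intro bexI[of _ "adjugate2 C"])
      (simp_all add: SL2Z_def matrix_inv_eq_adjugate2 adjugate2_adjugate2 det_adjugate2)
next
  assume "\<exists>U \<in> SL2Z. B = adjugate2 U ** A ** U"
  then obtain U where "det U = 1" "B = adjugate2 U ** A ** U"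
    by (auto simp: SL2Z_def)
  then show "integer_conjugate A B"
    unfolding integer_conjugate_def
    by (intro bexI[of _ "adjugate2 U"])
      (simp_all add: SL2Z_def matrix_inv_eq_adjugate2 adjugate2_adjugate2 det_adjugate2)
qed

text \<open>The outer coefficients fix the off-diagonal entries; the middle one and the trace are
  the difference and sum of the diagonal entries.\<close>

lemma matrix_eq_if_assoc_form_eq:
  assumes "assoc_form A = assoc_form B" "trace A = trace B"
  shows "A = B"
  using assms by (simp add: assoc_form_def trace_def sum_2 vec_eq_iff forall_2)

text \<open>The converse is confined to traces of equal sign because of
  \<open>assoc_form_opposite_traces\<close>.\<close>

theorem proposition3p1:
  fixes A B :: "int^2^2"
  assumes "A \<in> SL2Z" and "B \<in> SL2Z"
    and "hyperbolic A" and "hyperbolic B"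
  shows "(integer_conjugate A B \<longrightarrow>
            properly_equivalent_in Q_forms (assoc_form A) (assoc_form B)) \<and>
         ((A \<in> M_plus \<and> B \<in> M_plus) \<or> (A \<in> M_minus \<and> B \<in> M_minus) \<longrightarrow>
            (integer_conjugate A B \<longleftrightarrow>
             properly_equivalent_in Q_forms (assoc_form A) (assoc_form B)))"
proof -
  have equiv: "properly_equivalent_in Q_forms (assoc_form A) (assoc_form B)"
    if "integer_conjugate A B"
    using that assms assoc_form_in_Q_forms assoc_form_conjugate
    unfolding integer_conjugate_iff_adjugate2 properly_equivalent_in_def by blast
  have conj: "integer_conjugate A B"
    if sgn: "(A \<in> M_plus \<and> B \<in> M_plus) \<or> (A \<in> M_minus \<and> B \<in> M_minus)"
      and eq: "properly_equivalent_in Q_forms (assoc_form A) (assoc_form B)"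
  proof -
    obtain U where U: "U \<in> SL2Z" "assoc_form B = form_act U (assoc_form A)"
      using eq unfolding properly_equivalent_in_def by blast
    \<comment> \<open>This conjugate of \<open>A\<close> has the form of \<open>B\<close>, so only
      the traces remain to be compared.\<close>
    define A' where "A' = adjugate2 U ** A ** U"
    have form: "assoc_form A' = assoc_form B"
      by (simp add: A'_def U(2) assoc_form_conjugate)
    have AA': "integer_conjugate A A'"
      using U(1) unfolding integer_conjugate_iff_adjugate2 A'_def by blast
    have "A' \<in> SL2Z"
      using U(1) assms(1) by (simp add: A'_def SL2Z_def det_mul det_adjugate2)
    then have "(trace A)\<^sup>2 = (trace B)\<^sup>2"
      using discr_assoc_form[of A'] discr_assoc_form[OF assms(2)] form trace_conjugate[OF AA']
      by simp
    \<comment> \<open>The common sign rules out \<open>trace A = - trace B\<close>.\<close>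
    then have "trace A = trace B"
      using sgn by (auto simp: M_plus_def M_minus_def power2_eq_iff)
    then have "A' = B"
      using form trace_conjugate[OF AA'] by (simp add: matrix_eq_if_assoc_form_eq)
    then show ?thesis using AA' by simp
  qed
  show ?thesis using equiv conj by blast
qed

end
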